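(* Let $D>0$, $0<\lambda<q_0$, and let $\theta$ be uniformly distributed in $[-1,1]$. Consider the deterministic and stochastic Fokker-Planck equations of the aggregation/consensus model with constant diffusion on $\mathbb{R}$, $$\partial_\tau g-q_0\,\partial_v(vg)=\frac{D^2}{2}\partial_v^2g,\qquad \partial_\tau f-(q_0+\lambda\theta)\,\partial_v(vf)=\frac{D^2}{2}\partial_v^2f .$$ Their stationary probability densities are $$g^\infty(v)=\frac{\sqrt{q_0}}{D\sqrt\pi}e^{-q_0v^2/D^2},\qquad f^\infty(v;\theta)=\frac{\sqrt{q_0+\lambda\theta}}{D\sqrt\pi}e^{-(q_0+\lambda\theta)v^2/D^2},$$ with energies $E_{g^\infty}=\frac{D^2}{2q_0}$ and $E_{f^\infty}(\theta)=\frac{D^2}{2(q_0+\lambda\theta)}$. The $\theta$-averaged stationary distribution of the stochastic model is, for $v\ne0$, $$\bar f^\infty(v)=\frac1{v^2}\left(C_1e^{-(q_0-\lambda)v^2/D^2}+C_2e^{-(q_0+\lambda)v^2/D^2}+\frac{C_3(v)}{v}\right),$$ where $$C_1=\frac{D\sqrt{q_0-\lambda}}{2\lambda\sqrt\pi},\qquad C_2=-\frac{D\sqrt{q_0+\lambda}}{2\lambda\sqrt\pi},\qquad C_3(v)=\frac{D^2}{4\lambda}\left[\operatorname{Erf}\!\left(\frac{\sqrt{q_0+\lambda}}{D}v\right)-\operatorname{Erf}\!\left(\frac{\sqrt{q_0-\lambda}}{D}v\right)\right].$$ Moreover $$E_{\bar f^\infty}=\frac{D^2}{4\lambda}\log\left(\frac{q_0+\lambda}{q_0-\lambda}\right),\qquad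 \frac{E_{\bar f^\infty}}{E_{g^\infty}}=\frac{q_0}{2\lambda}\log\left(\frac{1+\frac{\lambda}{q_0}}{1-\frac{\lambda}{q_0}}\right)\ge1,$$ the ratio tending to $1$ as $\lambda\to0^+$, and $E_{\bar f^\infty}\to+\infty$ as $\lambda\to q_0^-$.
   Context: The unknowns are $g=g(\tau,v)$ and, for each fixed $\theta\in[-1,1]$, $f=f(\tau,v;\theta)$, with $\tau>0$, $v\in\mathbb{R}$. A stationary probability density is a $\tau$-independent nonnegative solution of unit integral over $\mathbb{R}$. The energy of a density $h$ on $\mathbb{R}$ is $E_h=\int_{\mathbb{R}}v^2h(v)\,dv$; $E_{f^\infty}(\theta)$ denotes the energy of $f^\infty(\cdot;\theta)$. The $\theta$-averaged distribution is $\bar f^\infty(v)=\frac12\int_{-1}^1f^\infty(v;\theta)\,d\theta$, and $E_{\bar f^\infty}$ is its energy, equal to $\frac12\int_{-1}^1E_{f^\infty}(\theta)\,d\theta$. $\operatorname{Erf}(x)=\frac2{\sqrt\pi}\int_0^xe^{-y^2}\,dy$. *)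

theory Defs
  imports "HOL-Probability.Probability"
begin

text \<open>
  Classical solutions, for time \<open>t > 0\<close>, of
  \<open>u\<^sub>t - a (v u)\<^sub>v = (D\<^sup>2 / 2) u\<^sub>v\<^sub>v\<close>. Since \<^const>\<open>deriv\<close> is total, the differentiability
  needed for each term to be meaningful is required explicitly.
\<close>

definition fokker_planck :: "real \<Rightarrow> real \<Rightarrow> (real \<Rightarrow> real \<Rightarrow> real) \<Rightarrow> bool" where
  "fokker_planck a D u \<longleftrightarrow>
     (\<forall>t>0. \<forall>v.
        (\<lambda>s. u s v) differentiable (at t) \<and>
        u t differentiable (at v) \<and>
        deriv (u t) differentiable (at v) \<and>
        deriv (\<lambda>s. u s v) t - a * deriv (\<lambda>w. w * u t w) v
          = D\<^sup>2 / 2 * deriv (deriv (u t)) v)"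

definition deterministic_fp :: "real \<Rightarrow> real \<Rightarrow> (real \<Rightarrow> real \<Rightarrow> real) \<Rightarrow> bool" where
  "deterministic_fp q0 D g \<longleftrightarrow> fokker_planck q0 D g"

definition stochastic_fp :: "real \<Rightarrow> real \<Rightarrow> real \<Rightarrow> real \<Rightarrow> (real \<Rightarrow> real \<Rightarrow> real) \<Rightarrow> bool" where
  "stochastic_fp q0 lam D \<theta> f \<longleftrightarrow> fokker_planck (q0 + lam * \<theta>) D f"

definition prob_density :: "(real \<Rightarrow> real) \<Rightarrow> bool" where
  "prob_density h \<longleftrightarrow> (\<forall>v. 0 \<le> h v) \<and> has_bochner_integral lborel h 1"

text \<open>The first argument is the evolution equation, as a predicate on functions of time and \<open>v\<close>.\<close>

definition stationary_density ::
    "((real \<Rightarrow> real \<Rightarrow> real) \<Rightarrow> bool) \<Rightarrow> (real \<Rightarrow> real) \<Rightarrow> bool" where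
  "stationary_density eqn h \<longleftrightarrow> prob_density h \<and> eqn (\<lambda>t. h)"

text \<open>
  A Bochner integral is \<open>0\<close> when the integrand is not integrable, so a nonzero value
  of \<open>energy h\<close> entails that the second moment is finite.
\<close>

definition energy :: "(real \<Rightarrow> real) \<Rightarrow> real" where
  "energy h = (LBINT v. v\<^sup>2 * h v)"

definition g_inf :: "real \<Rightarrow> real \<Rightarrow> real \<Rightarrow> real" where
  "g_inf q0 D v = sqrt q0 / (D * sqrt pi) * exp (- (q0 * v\<^sup>2 / D\<^sup>2))"

definition f_inf :: "real \<Rightarrow> real \<Rightarrow> real \<Rightarrow> real \<Rightarrow> real \<Rightarrow> real" where
  "f_inf q0 lam D v \<theta> =
     sqrt (q0 + lam * \<theta>) / (D * sqrt pi) * exp (- ((q0 + lam * \<theta>) * v\<^sup>2 / D\<^sup>2))"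

definition f_bar :: "real \<Rightarrow> real \<Rightarrow> real \<Rightarrow> real \<Rightarrow> real" where
  "f_bar q0 lam D v = 1 / 2 * (LBINT \<theta>:{-1..1}. f_inf q0 lam D v \<theta>)"

text \<open>The interval integral is oriented, so \<open>Erf\<close> is odd.\<close>

definition Erf :: "real \<Rightarrow> real" where
  "Erf x = 2 / sqrt pi * (LBINT y=ereal 0..ereal x. exp (- y\<^sup>2))"

definition C1 :: "real \<Rightarrow> real \<Rightarrow> real \<Rightarrow> real" where
  "C1 q0 lam D = D * sqrt (q0 - lam) / (2 * lam * sqrt pi)"

definition C2 :: "real \<Rightarrow> real \<Rightarrow> real \<Rightarrow> real" where
  "C2 q0 lam D = - (D * sqrt (q0 + lam) / (2 * lam * sqrt pi))"

definition C3 :: "real \<Rightarrow> real \<Rightarrow> real \<Rightarrow> real \<Rightarrow> real" where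
  "C3 q0 lam D v =
     D\<^sup>2 / (4 * lam) * (Erf (sqrt (q0 + lam) / D * v) - Erf (sqrt (q0 - lam) / D * v))"

end

(*
  The flux D^2/2 h' + a v h of a stationary solution h is constant in v, so
  (exp (a v^2 / D^2) h(v))' = b exp (a v^2 / D^2) for a constant b. If b were nonzero, h would become
  negative on one side of the origin; hence b = 0 and h is a Gaussian. The averaged density comes from
  an integration by parts in s = q0 + lam * theta, and its energy from Tonelli's theorem.
*)
theory Submission
  imports Defs "HOL-Real_Asymp.Real_Asymp"
begin

section \<open>Gaussian densities: mass and second moment\<close>

text \<open>Identifying the variance as D^2 / (2 a) makes the known moments of the normal
  distribution available for mass and energy.\<close>

lemma g_inf_eq_normal_density:
  assumes "0 < a" "0 < D"
  shows "g_inf a D = normal_density 0 (D / sqrt (2 * a))"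
proof
  fix v
  have "2 * pi * (D / sqrt (2 * a))\<^sup>2 = D\<^sup>2 * pi / a"
    using assms by (simp add: power_divide)
  then have "1 / sqrt (2 * pi * (D / sqrt (2 * a))\<^sup>2) = sqrt a / (D * sqrt pi)"
    using assms by (simp add: real_sqrt_mult real_sqrt_divide)
  moreover have "- (v - 0)\<^sup>2 / (2 * (D / sqrt (2 * a))\<^sup>2) = - (a * v\<^sup>2 / D\<^sup>2)"
    using assms by (simp add: power_divide field_simps)
  ultimately show "g_inf a D v = normal_density 0 (D / sqrt (2 * a)) v"
    unfolding g_inf_def normal_density_def by simp
qed

text \<open>For fixed \<theta> the stochastic model is the deterministic one with rate
  \<open>q0 + lam * \<theta>\<close>, so every fact about \<open>g_inf\<close> transfers to
  \<open>f_inf\<close>.\<close>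

lemma f_inf_eq_g_inf: "f_inf q0 lam D v \<theta> = g_inf (q0 + lam * \<theta>) D v"
  by (simp add: f_inf_def g_inf_def)

lemma has_bochner_integral_g_inf:
  assumes "0 < a" "0 < D"
  shows "has_bochner_integral lborel (g_inf a D) 1"
  using normal_moment_even[of "D / sqrt (2 * a)" 0 0] assms
  by (simp add: g_inf_eq_normal_density)

lemma has_bochner_integral_second_moment_g_inf:
  assumes "0 < a" "0 < D"
  shows "has_bochner_integral lborel (\<lambda>v. v\<^sup>2 * g_inf a D v) (D\<^sup>2 / (2 * a))"
  \<comment> \<open>The last argument 1 selects the moment of order 2, which is the variance of a
    centred normal law.\<close>
  using normal_moment_even[of "D / sqrt (2 * a)" 0 1] assms
  by (simp add: g_inf_eq_normal_density power_divide mult.commute)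

lemma g_inf_nonneg:
  assumes "0 < a" "0 < D"
  shows "0 \<le> g_inf a D v"
  using assms by (simp add: g_inf_eq_normal_density)

lemma energy_g_inf:
  assumes "0 < a" "0 < D"
  shows "energy (g_inf a D) = D\<^sup>2 / (2 * a)"
  unfolding energy_def
  by (rule has_bochner_integral_integral_eq[OF has_bochner_integral_second_moment_g_inf[OF assms]])

section \<open>Stationary solutions of the Fokker-Planck equation\<close>

lemma fokker_planck_stationary_nonneg_imp_gaussian:
  assumes "0 < a" "0 < D" and fp: "fokker_planck a D (\<lambda>t. h)" and nonneg: "\<And>v. 0 \<le> h v"
  obtains A where "h = (\<lambda>v. A * exp (- (a * v\<^sup>2 / D\<^sup>2)))"
proof -
  have h: "(h has_real_derivative deriv h v) (at v)" for v
    using fp DERIV_deriv_iff_real_differentiable unfolding fokker_planck_def by (meson zero_less_one)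
  have h': "(deriv h has_real_derivative deriv (deriv h) v) (at v)" for v
    using fp DERIV_deriv_iff_real_differentiable unfolding fokker_planck_def by (meson zero_less_one)
  have vh: "((\<lambda>w. w * h w) has_real_derivative h v + v * deriv h v) (at v)" for v
    by (auto intro!: derivative_eq_intros h)
  have ode: "D\<^sup>2 / 2 * deriv (deriv h) v + a * (h v + v * deriv h v) = 0" for v
  proof -
    \<comment> \<open>Time 1 stands for any positive time: \<open>h\<close> does not depend on time,
      so the time derivative vanishes.\<close>
    have "deriv (\<lambda>s::real. h v) 1 - a * deriv (\<lambda>w. w * h w) v = D\<^sup>2 / 2 * deriv (deriv h) v"
      using fp unfolding fokker_planck_def by (meson zero_less_one)
    then show ?thesis using DERIV_imp_deriv[OF vh] by simp
  qed
  define F where "F v = D\<^sup>2 / 2 * deriv h v + a * (v * h v)" for v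
  \<comment> \<open>Reading \<open>ode\<close> from right to left replaces the derivative 0 by the
    very sum that the differentiation rules produce for the flux \<open>F\<close>.\<close>
  have "(F has_real_derivative 0) (at v)" for v
    unfolding F_def[abs_def] ode[of v, symmetric]
    by (intro DERIV_add DERIV_cmult h' vh)
  then have F_const: "F v = F 0" for v
    using DERIV_isconst_all by blast
  define b where "b = 2 * F 0 / D\<^sup>2"
  define G where "G v = exp (a * v\<^sup>2 / D\<^sup>2) * h v" for v
  have G: "(G has_real_derivative b * exp (a * v\<^sup>2 / D\<^sup>2)) (at v)" for v
  proof -
    have "b = 2 * F v / D\<^sup>2"
      by (simp add: b_def F_const[of v])
    also have "\<dots> = deriv h v + 2 * a * v / D\<^sup>2 * h v"
      using \<open>0 < D\<close> by (simp add: F_def field_simps)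
    finally have b: "b = deriv h v + 2 * a * v / D\<^sup>2 * h v" .
    have "((\<lambda>v. a * v\<^sup>2 / D\<^sup>2) has_real_derivative 2 * a * v / D\<^sup>2) (at v)"
      by (rule DERIV_cdivide) (auto intro!: derivative_eq_intros)
    from DERIV_mult[OF DERIV_chain2[OF DERIV_exp this] h] show ?thesis
      unfolding G_def[abs_def] b by (simp add: algebra_simps)
  qed
  have G_nonneg: "0 \<le> G v" for v
    by (simp add: G_def nonneg)
  have "b = 0"
  proof (rule ccontr)
    assume "b \<noteq> 0"
    \<comment> \<open>Chosen so that \<open>b * v = - (G 0 + 1)\<close>, whatever the sign of
      \<open>b\<close>. Since the exponential is at least 1, the mean value theorem gives
      \<open>G v - G 0 \<le> - (G 0 + 1)\<close>, that is, \<open>G v \<le> -1\<close>.\<close>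
    define v where "v = - (G 0 + 1) / b"
    have "v \<noteq> 0" using G_nonneg[of 0] \<open>b \<noteq> 0\<close> by (simp add: v_def)
    \<comment> \<open>The mean value theorem wants ordered endpoints, hence the case split; both
      orders lead to the same identity.\<close>
    obtain x where x: "G v - G 0 = v * (b * exp (a * x\<^sup>2 / D\<^sup>2))"
    proof (cases "0 < v")
      case True
      then show thesis using MVT2[of 0 v G "\<lambda>v. b * exp (a * v\<^sup>2 / D\<^sup>2)"] G that by auto
    next
      case False
      then have "v < 0" using \<open>v \<noteq> 0\<close> by simp
      then obtain z where "G 0 - G v = (0 - v) * (b * exp (a * z\<^sup>2 / D\<^sup>2))"
        using MVT2[of v 0 G "\<lambda>v. b * exp (a * v\<^sup>2 / D\<^sup>2)"] G by blast
      then show thesis by (intro that[of z]) simp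
    qed
    also have "\<dots> = - ((G 0 + 1) * exp (a * x\<^sup>2 / D\<^sup>2))"
      using \<open>b \<noteq> 0\<close> by (simp add: v_def field_simps)
    also have "\<dots> \<le> - ((G 0 + 1) * 1)"
      unfolding neg_le_iff_le using G_nonneg[of 0] \<open>0 < a\<close> by (intro mult_left_mono) auto
    finally show False using G_nonneg[of v] by simp
  qed
  then have "G v = G 0" for v
    using G by (intro DERIV_isconst_all[of G]) simp
  then have "h v = G 0 * exp (- (a * v\<^sup>2 / D\<^sup>2))" for v
    by (simp add: G_def exp_minus field_simps)
  then show thesis by (intro that) blast
qed

text \<open>The Gaussian has zero flux: its derivative is - (2 a / D^2) v g, so diffusion and drift
  cancel.\<close>

lemma fokker_planck_g_inf: "fokker_planck a D (\<lambda>t. g_inf a D)" if "0 < D"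
proof -
  define c where "c = sqrt a / (D * sqrt pi)"
  have g: "g_inf a D = (\<lambda>v. c * exp (- (a * v\<^sup>2 / D\<^sup>2)))"
    by (simp add: g_inf_def c_def fun_eq_iff)
  have d1: "(g_inf a D has_real_derivative - (2 * a / D\<^sup>2) * (v * g_inf a D v)) (at v)" for v
    unfolding g using that by (auto intro!: derivative_eq_intros simp: field_simps)
  then have d1': "deriv (g_inf a D) = (\<lambda>v. - (2 * a / D\<^sup>2) * (v * g_inf a D v))"
    by (auto intro: DERIV_imp_deriv)
  \<comment> \<open>The derivative of v g is kept symbolic, so that the drift term of the equation
    cancels it without being expanded.\<close>
  have dv: "((\<lambda>w. w * g_inf a D w) has_real_derivative deriv (\<lambda>w. w * g_inf a D w) v) (at v)" for v
  proof -
    have "((\<lambda>w. w * g_inf a D w) has_real_derivative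
        g_inf a D v + v * (- (2 * a / D\<^sup>2) * (v * g_inf a D v))) (at v)"
      by (auto intro!: derivative_eq_intros d1)
    then show ?thesis using DERIV_imp_deriv by metis
  qed
  have d2: "(deriv (g_inf a D) has_real_derivative
      - (2 * a / D\<^sup>2) * deriv (\<lambda>w. w * g_inf a D w) v) (at v)" for v
    unfolding d1' by (intro DERIV_cmult dv)
  show ?thesis
    unfolding fokker_planck_def
    using d1 d2 DERIV_imp_deriv[OF d2] that by (auto simp: real_differentiable_def)
qed

lemma stationary_density_fokker_planck_iff:
  assumes "0 < a" "0 < D"
  shows "stationary_density (fokker_planck a D) h \<longleftrightarrow> h = g_inf a D"
proof
  assume h: "stationary_density (fokker_planck a D) h"
  then have "fokker_planck a D (\<lambda>t. h)" "\<And>v. 0 \<le> h v"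
    and one: "has_bochner_integral lborel h 1"
    by (auto simp: stationary_density_def prob_density_def)
  then obtain A where A: "h = (\<lambda>v. A * exp (- (a * v\<^sup>2 / D\<^sup>2)))"
    using fokker_planck_stationary_nonneg_imp_gaussian[OF assms] by metis
  \<comment> \<open>Measured against the Gaussian of unit mass, the free constant becomes the total
    mass of \<open>h\<close>, and uniqueness of the integral forces it to be 1.\<close>
  define B where "B = A * (D * sqrt pi) / sqrt a"
  have B: "h = (\<lambda>v. B * g_inf a D v)"
    using assms by (simp add: A B_def g_inf_def fun_eq_iff)
  have "has_bochner_integral lborel h (B * 1)"
    unfolding B by (intro has_bochner_integral_mult_right has_bochner_integral_g_inf assms)
  with one have "B = 1" using has_bochner_integral_eq by fastforce
  then show "h = g_inf a D" using B by simp
next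
  assume "h = g_inf a D"
  then show "stationary_density (fokker_planck a D) h"
    using assms
    by (simp add: stationary_density_def prob_density_def g_inf_nonneg has_bochner_integral_g_inf
        fokker_planck_g_inf)
qed

section \<open>The error function and the averaged density\<close>

lemma has_real_derivative_Erf:
  "(Erf has_real_derivative 2 / sqrt pi * exp (- x\<^sup>2)) (at x)"
proof -
  \<comment> \<open>The interval from \<open>-r\<close> to \<open>r\<close> has both 0 and
    \<open>x\<close> in its interior, so the one-interval fundamental theorem yields a two-sided
    derivative at \<open>x\<close>.\<close>
  define r where "r = \<bar>x\<bar> + 1"
  have "((\<lambda>u. LBINT y=0..u. exp (- y\<^sup>2)) has_vector_derivative exp (- x\<^sup>2)) (at x within {-r..r})"
    unfolding zero_ereal_def
    by (intro interval_integral_FTC2) (auto simp: r_def intro!: continuous_intros)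
  moreover have "at x within {-r..r} = at x"
    by (intro at_within_interior) (auto simp: r_def)
  ultimately have "((\<lambda>u. LBINT y=0..u. exp (- y\<^sup>2)) has_real_derivative exp (- x\<^sup>2)) (at x)"
    by (simp add: has_real_derivative_iff_has_vector_derivative)
  then show ?thesis
    unfolding Erf_def[abs_def] zero_ereal_def by (rule DERIV_cmult)
qed

text \<open>The smallest rate occurs at \<theta> = -1 and equals \<open>q - lam\<close>; thus the
  Gaussian facts apply for every \<theta> in the range.\<close>

lemma mixture_weight_pos:
  fixes q lam \<theta> :: real
  assumes "0 < lam" "lam < q" "\<theta> \<in> {-1..1}"
  shows "0 < q + lam * \<theta>"
proof -
  have "lam * (-1) \<le> lam * \<theta>" using assms by (intro mult_left_mono) auto
  then show ?thesis using assms by simp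
qed

lemma isCont_f_inf:
  assumes "D \<noteq> 0"
  shows "isCont (f_inf q0 lam D v) \<theta>"
  unfolding f_inf_def[abs_def] using assms by (auto intro!: continuous_intros)

lemma f_bar_eq:
  assumes "0 < D" "0 < lam" "lam < q0" "v \<noteq> 0"
  shows "f_bar q0 lam D v =
        1 / v\<^sup>2 * (C1 q0 lam D * exp (- ((q0 - lam) * v\<^sup>2 / D\<^sup>2))
                 + C2 q0 lam D * exp (- ((q0 + lam) * v\<^sup>2 / D\<^sup>2))
                 + C3 q0 lam D v / v)"
proof -
  \<comment> \<open>An antiderivative in s of the density divided by \<open>lam\<close>, the slope
    of s = q0 + lam \<theta>. The first summand is the boundary term of the integration by parts;
    the second is the remaining integral of exp (- s v^2 / D^2) / sqrt s, evaluated by y = sqrt s v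
    / D.\<close>
  define P where "P s = - (D / (lam * sqrt pi * v\<^sup>2)) * (sqrt s * exp (- (s * v\<^sup>2 / D\<^sup>2)))
    + D\<^sup>2 / (2 * lam * v ^ 3) * Erf (sqrt s / D * v)" for s
  have P: "(P has_real_derivative sqrt s / (D * sqrt pi) * exp (- (s * v\<^sup>2 / D\<^sup>2)) / lam) (at s)"
    if "0 < s" for s
  proof -
    define e where "e = exp (- (s * v\<^sup>2 / D\<^sup>2))"
    define r where "r = sqrt s"
    have r: "0 < r" "s = r\<^sup>2" using that by (auto simp: r_def)
    have "(sqrt s / D * v)\<^sup>2 = s * v\<^sup>2 / D\<^sup>2"
      using that by (simp add: power_mult_distrib power_divide)
    then have "((\<lambda>s. Erf (sqrt s / D * v)) has_real_derivative
        2 / sqrt pi * e * (inverse r / 2 / D * v)) (at s)"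
      using DERIV_chain2[OF has_real_derivative_Erf, of "\<lambda>s. sqrt s / D * v" "inverse r / 2 / D * v" s]
        that DERIV_cmult_right[OF DERIV_cdivide[OF DERIV_real_sqrt[OF that], of D], of v]
      by (simp add: e_def r_def)
    moreover have "((\<lambda>s. sqrt s * exp (- (s * v\<^sup>2 / D\<^sup>2))) has_real_derivative
        inverse r / 2 * e - r * (v\<^sup>2 / D\<^sup>2) * e) (at s)"
    proof -
      have "((\<lambda>s. - (s * v\<^sup>2 / D\<^sup>2)) has_real_derivative - (v\<^sup>2 / D\<^sup>2)) (at s)"
        by (intro DERIV_minus DERIV_cdivide) (auto intro!: derivative_eq_intros)
      from DERIV_mult[OF DERIV_real_sqrt[OF that] DERIV_chain2[OF DERIV_exp this]] show ?thesis
        by (simp add: e_def r_def algebra_simps)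
    qed
    ultimately have "(P has_real_derivative
        - (D / (lam * sqrt pi * v\<^sup>2)) * (inverse r / 2 * e - r * (v\<^sup>2 / D\<^sup>2) * e)
        + D\<^sup>2 / (2 * lam * v ^ 3) * (2 / sqrt pi * e * (inverse r / 2 / D * v))) (at s)"
      unfolding P_def[abs_def] by (intro DERIV_add DERIV_cmult)
    \<comment> \<open>The two terms with \<open>inverse r\<close> cancel. With \<open>r\<close> for
      the square root and \<open>e\<close> for the exponential, this is a purely rational
      identity.\<close>
    moreover have "- (D / (lam * sqrt pi * v\<^sup>2)) * (inverse r / 2 * e - r * (v\<^sup>2 / D\<^sup>2) * e)
        + D\<^sup>2 / (2 * lam * v ^ 3) * (2 / sqrt pi * e * (inverse r / 2 / D * v))
        = r / (D * sqrt pi) * e / lam"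
      using r assms by (simp add: field_simps power2_eq_square power3_eq_cube)
    ultimately show ?thesis by (simp add: e_def r_def)
  qed
  have "((\<lambda>\<theta>. P (q0 + lam * \<theta>)) has_real_derivative f_inf q0 lam D v \<theta>) (at \<theta>)"
    if "\<theta> \<in> {-1..1}" for \<theta>
  proof -
    have "((\<lambda>\<theta>. q0 + lam * \<theta>) has_real_derivative lam) (at \<theta>)"
      by (auto intro!: derivative_eq_intros)
    from DERIV_chain2[OF P this] mixture_weight_pos[OF assms(2,3) that] show ?thesis
      using \<open>0 < lam\<close> by (simp add: f_inf_def)
  qed
  then have integral: "(LBINT \<theta>:{-1..1}. f_inf q0 lam D v \<theta>) = P (q0 + lam) - P (q0 - lam)"
    using integral_FTC_Icc_real[of "-1" 1 "\<lambda>\<theta>. P (q0 + lam * \<theta>)" "f_inf q0 lam D v"]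
      isCont_f_inf[of D] \<open>0 < D\<close>
    by (simp add: set_lebesgue_integral_def mult.commute)
  \<comment> \<open>Roots, exponentials and values of \<open>Erf\<close> become free variables,
    index 1 for the upper limit \<open>q0 + lam\<close> and 2 for the lower \<open>q0 - lam\<close>,
    so that only field arithmetic remains.\<close>
  have boundary_terms: "1 / 2 * ((- (D / (lam * p * v\<^sup>2)) * (r1 * e1) + D\<^sup>2 / (2 * lam * v ^ 3) * E1)
        - (- (D / (lam * p * v\<^sup>2)) * (r2 * e2) + D\<^sup>2 / (2 * lam * v ^ 3) * E2))
      = 1 / v\<^sup>2 * (D * r2 / (2 * lam * p) * e2 + - (D * r1 / (2 * lam * p)) * e1
        + D\<^sup>2 / (4 * lam) * (E1 - E2) / v)"
    if "p \<noteq> 0" for p r1 r2 e1 e2 E1 E2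
    using assms that by (simp add: field_simps power2_eq_square power3_eq_cube)
  show ?thesis
    unfolding f_bar_def integral P_def C1_def C2_def C3_def by (rule boundary_terms) simp
qed

section \<open>Averaging over \<theta>: energy and expectation\<close>

text \<open>The two sides differ in the order of integration over v and \<theta>. The exchange is
  legitimate because the rates stay away from 0, so the second moments are integrable over
  \<theta>.\<close>

lemma energy_f_bar_eq_average:
  assumes "0 < D" "0 < lam" "lam < q0"
  shows "energy (f_bar q0 lam D)
    = 1 / 2 * (LBINT \<theta>:{-1..1}. energy (\<lambda>v. f_inf q0 lam D v \<theta>))"
proof -
  \<comment> \<open>The indicator extends the \<theta>-integral to the whole line, where the product
    theorems for \<open>lborel\<close> apply.\<close>
  define k where "k \<theta> v = indicator {-1..1} \<theta> * (v\<^sup>2 * f_inf q0 lam D v \<theta>)" for \<theta> v :: real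
  have k: "has_bochner_integral lborel (k \<theta>) (indicator {-1..1} \<theta> * (D\<^sup>2 / (2 * (q0 + lam * \<theta>))))"
    for \<theta>
  proof (cases "\<theta> \<in> {-1..1}")
    case True
    then show ?thesis
      using has_bochner_integral_second_moment_g_inf[of "q0 + lam * \<theta>" D]
        mixture_weight_pos[OF assms(2,3) True] assms
      by (simp add: k_def[abs_def] f_inf_eq_g_inf)
  qed (simp add: k_def[abs_def] has_bochner_integral_zero)
  have k_nonneg: "0 \<le> k \<theta> v" for \<theta> v
    using assms g_inf_nonneg[OF mixture_weight_pos[OF assms(2,3)]]
    by (auto simp: k_def f_inf_eq_g_inf indicator_def)
  have "continuous_on {-1..1} (\<lambda>\<theta>. D\<^sup>2 / (2 * (q0 + lam * \<theta>)))"
    using mixture_weight_pos[OF assms(2,3)] by (intro continuous_intros) force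
  from borel_integrable_atLeastAtMost'[OF this]
  have "integrable lborel (\<lambda>\<theta>. indicator {-1..1} \<theta> * (D\<^sup>2 / (2 * (q0 + lam * \<theta>))))"
    by (simp add: set_integrable_def)
  \<comment> \<open>As \<open>k\<close> is nonnegative, the integral of its norm is again the second
    moment; this is the condition for joint integrability.\<close>
  moreover have "(\<integral>v. norm (k \<theta> v) \<partial>lborel) = indicator {-1..1} \<theta> * (D\<^sup>2 / (2 * (q0 + lam * \<theta>)))" for \<theta>
    using has_bochner_integral_integral_eq[OF k] k_nonneg by simp
  moreover have "case_prod k \<in> borel_measurable (lborel \<Otimes>\<^sub>M lborel)"
    unfolding k_def[abs_def] f_inf_def by measurable
  ultimately have "integrable (lborel \<Otimes>\<^sub>M lborel) (case_prod k)"
    using k by (intro lborel_pair.Fubini_integrable) (auto intro: integrable.intros)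
  then have "(\<integral>v. \<integral>\<theta>. k \<theta> v \<partial>lborel \<partial>lborel) = (\<integral>\<theta>. \<integral>v. k \<theta> v \<partial>lborel \<partial>lborel)"
    by (rule lborel_pair.Fubini_integral)
  moreover have "(\<integral>\<theta>. k \<theta> v \<partial>lborel) = 2 * (v\<^sup>2 * f_bar q0 lam D v)" for v
    by (simp add: k_def f_bar_def set_lebesgue_integral_def mult.left_commute[of _ "v\<^sup>2"])
  moreover have "(\<integral>v. k \<theta> v \<partial>lborel) = indicator {-1..1} \<theta> * energy (\<lambda>v. f_inf q0 lam D v \<theta>)" for \<theta>
    by (simp add: k_def energy_def)
  ultimately show ?thesis
    by (simp add: energy_def[of "f_bar q0 lam D"] set_lebesgue_integral_def)
qed

lemma energy_f_inf:
  assumes "0 < D" "0 < lam" "lam < q0" "\<theta> \<in> {-1..1}"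
  shows "energy (\<lambda>v. f_inf q0 lam D v \<theta>) = D\<^sup>2 / (2 * (q0 + lam * \<theta>))"
  using energy_g_inf[OF mixture_weight_pos[OF assms(2,3,4)] assms(1)] by (simp add: f_inf_eq_g_inf)

lemma energy_f_bar:
  assumes "0 < D" "0 < lam" "lam < q0"
  shows "energy (f_bar q0 lam D) = D\<^sup>2 / (4 * lam) * ln ((q0 + lam) / (q0 - lam))"
proof -
  \<comment> \<open>An antiderivative in \<theta> of the energy D^2 / (2 (q0 + lam \<theta>)); the
    factor 1 / lam compensates the inner derivative.\<close>
  define L where "L \<theta> = D\<^sup>2 / (2 * lam) * ln (q0 + lam * \<theta>)" for \<theta>
  have "(LBINT \<theta>:{-1..1}. energy (\<lambda>v. f_inf q0 lam D v \<theta>))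
      = (LBINT \<theta>:{-1..1}. D\<^sup>2 / (2 * (q0 + lam * \<theta>)))"
    using energy_f_inf[OF assms] by (intro set_lebesgue_integral_cong) auto
  also have "\<dots> = (\<integral>\<theta>. D\<^sup>2 / (2 * (q0 + lam * \<theta>)) * indicator {-1..1} \<theta> \<partial>lborel)"
    by (simp add: set_lebesgue_integral_def mult.commute)
  also have "\<dots> = L 1 - L (-1)"
  proof (rule integral_FTC_Icc_real)
    fix \<theta> :: real
    assume "-1 \<le> \<theta>" "\<theta> \<le> 1"
    then have pos: "0 < q0 + lam * \<theta>" using mixture_weight_pos[OF assms(2,3)] by simp
    then show "(L has_real_derivative D\<^sup>2 / (2 * (q0 + lam * \<theta>))) (at \<theta>)"
    proof -
      have "((\<lambda>\<theta>. ln (q0 + lam * \<theta>)) has_real_derivative lam / (q0 + lam * \<theta>)) (at \<theta>)"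
        using pos by (auto intro!: derivative_eq_intros)
      from DERIV_cmult[OF this, of "D\<^sup>2 / (2 * lam)"] show ?thesis
        unfolding L_def[abs_def] using \<open>0 < lam\<close> by simp
    qed
    show "isCont (\<lambda>\<theta>. D\<^sup>2 / (2 * (q0 + lam * \<theta>))) \<theta>"
      using pos by (intro continuous_intros) auto
  qed simp
  also have "\<dots> = D\<^sup>2 / (2 * lam) * ln ((q0 + lam) / (q0 - lam))"
    using assms by (simp add: L_def ln_div right_diff_distrib)
  finally show ?thesis
    by (simp add: energy_f_bar_eq_average[OF assms])
qed

text \<open>Ties the integral defining \<open>f_bar\<close> to a uniformly distributed random
  variable: the interval has length 2, whence the factor 1 / 2.\<close>

lemma f_bar_eq_expectation:
  assumes "D \<noteq> 0"
    and X: "distributed M lborel X (\<lambda>x. indicator {-1..1} x / measure lborel {-1..1::real})"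
  shows "f_bar q0 lam D v = (LINT \<omega>|M. f_inf q0 lam D v (X \<omega>))"
proof -
  have "f_inf q0 lam D v \<in> borel_measurable lborel"
    unfolding f_inf_def[abs_def] by measurable
  from distributed_integral[OF X this] show ?thesis
    by (simp add: f_bar_def set_lebesgue_integral_def)
qed

section \<open>The energy ratio and the limits in lam\<close>

lemma energy_ratio:
  assumes "0 < D" "0 < lam" "lam < q0"
  shows "energy (f_bar q0 lam D) / energy (g_inf q0 D)
    = q0 / (2 * lam) * ln ((1 + lam / q0) / (1 - lam / q0))"
proof -
  have "(1 + lam / q0) / (1 - lam / q0) = (q0 + lam) / (q0 - lam)"
    using assms by (simp add: field_simps)
  moreover have "D\<^sup>2 / (4 * lam) * l / (D\<^sup>2 / (2 * q0)) = q0 / (2 * lam) * l" for l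
    using assms by (simp add: field_simps)
  ultimately show ?thesis
    using assms by (simp only: energy_f_bar energy_g_inf)
qed

text \<open>With x = lam / q0 the claim is ln ((1 + x) / (1 - x)) \<ge> 2 x. This is the midpoint
  bound for the integral of the convex function 1 / t from 1 - x to 1 + x, whose midpoint is
  1.\<close>

lemma energy_ratio_ge_1:
  fixes lam q0 :: real
  assumes "0 < lam" "lam < q0"
  shows "1 \<le> q0 / (2 * lam) * ln ((1 + lam / q0) / (1 - lam / q0))"
proof -
  define x where "x = lam / q0"
  have x: "0 < x" "x < 1" using assms by (auto simp: x_def)
  then have "2 * x \<le> ln ((1 + x) / (1 - x))"
    using ln_inverse_approx_ge[of "1 - x" "1 + x"] by (simp add: ln_div)
  then have "1 \<le> ln ((1 + x) / (1 - x)) / (2 * x)"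
    using x by simp
  then show ?thesis
    by (simp add: x_def mult.commute)
qed

lemma tendsto_energy_ratio:
  assumes "0 < D" "0 < q0"
  shows "((\<lambda>l. energy (f_bar q0 l D) / energy (g_inf q0 D)) \<longlongrightarrow> 1) (at_right 0)"
proof -
  have "((\<lambda>l. q0 / (2 * l) * ln ((1 + l / q0) / (1 - l / q0))) \<longlongrightarrow> 1) (at_right 0)"
    using \<open>0 < q0\<close> by real_asymp
  \<comment> \<open>The closed form is established for 0 < l < q0, which holds eventually on the
    right of 0.\<close>
  moreover have "\<forall>\<^sub>F l in at_right 0. q0 / (2 * l) * ln ((1 + l / q0) / (1 - l / q0))
      = energy (f_bar q0 l D) / energy (g_inf q0 D)"
    using eventually_at_right_less[of 0] eventually_at_right_real[OF \<open>0 < q0\<close>]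
    by eventually_elim (use assms energy_ratio in auto)
  ultimately show ?thesis by (rule Lim_transform_eventually)
qed

text \<open>As l increases to q0, the logarithm diverges because q0 - l tends to 0 from above, while
  its prefactor tends to the positive number D^2 / (4 q0).\<close>

lemma filterlim_energy_f_bar:
  assumes "0 < D" "0 < q0"
  shows "filterlim (\<lambda>l. energy (f_bar q0 l D)) at_top (at_left q0)"
proof -
  have "filterlim (\<lambda>l. D\<^sup>2 / (4 * l) * ln ((q0 + l) / (q0 - l))) at_top (at_left q0)"
    using assms by real_asymp
  moreover have "\<forall>\<^sub>F l in at_left q0.
      D\<^sup>2 / (4 * l) * ln ((q0 + l) / (q0 - l)) = energy (f_bar q0 l D)"
    using eventually_at_left_real[OF \<open>0 < q0\<close>]
    by eventually_elim (use assms energy_f_bar in auto)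
  ultimately show ?thesis
    by (subst filterlim_cong[OF refl refl]) (auto elim: eventually_mono)
qed

theorem mainTheorem5:
  fixes D q0 lam :: real and M :: "'a measure" and \<Theta> :: "'a \<Rightarrow> real"
  assumes "0 < D" and "0 < lam" and "lam < q0"
    and "prob_space M"
    and "distributed M lborel \<Theta> (\<lambda>x. indicator {-1..1} x / measure lborel {-1..1::real})"
  shows
    "(\<forall>h. stationary_density (deterministic_fp q0 D) h \<longleftrightarrow> h = g_inf q0 D) \<and>
     (\<forall>\<theta>\<in>{-1..1}. \<forall>h. stationary_density (stochastic_fp q0 lam D \<theta>) h
        \<longleftrightarrow> h = (\<lambda>v. f_inf q0 lam D v \<theta>)) \<and>
     energy (g_inf q0 D) = D\<^sup>2 / (2 * q0) \<and>
     (\<forall>\<theta>\<in>{-1..1}. energy (\<lambda>v. f_inf q0 lam D v \<theta>) = D\<^sup>2 / (2 * (q0 + lam * \<theta>))) \<and>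
     (\<forall>v. f_bar q0 lam D v = (LINT \<omega>|M. f_inf q0 lam D v (\<Theta> \<omega>))) \<and>
     (\<forall>v. v \<noteq> 0 \<longrightarrow> f_bar q0 lam D v =
        1 / v\<^sup>2 * (C1 q0 lam D * exp (- ((q0 - lam) * v\<^sup>2 / D\<^sup>2))
                 + C2 q0 lam D * exp (- ((q0 + lam) * v\<^sup>2 / D\<^sup>2))
                 + C3 q0 lam D v / v)) \<and>
     energy (f_bar q0 lam D)
       = 1 / 2 * (LBINT \<theta>:{-1..1}. energy (\<lambda>v. f_inf q0 lam D v \<theta>)) \<and>
     energy (f_bar q0 lam D) = D\<^sup>2 / (4 * lam) * ln ((q0 + lam) / (q0 - lam)) \<and>
     energy (f_bar q0 lam D) / energy (g_inf q0 D)
       = q0 / (2 * lam) * ln ((1 + lam / q0) / (1 - lam / q0)) \<and>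
     q0 / (2 * lam) * ln ((1 + lam / q0) / (1 - lam / q0)) \<ge> 1 \<and>
     ((\<lambda>l. energy (f_bar q0 l D) / energy (g_inf q0 D)) \<longlongrightarrow> 1) (at_right 0) \<and>
     filterlim (\<lambda>l. energy (f_bar q0 l D)) at_top (at_left q0)"
proof -
  have q0: "0 < q0" using assms by simp
  \<comment> \<open>The equation is passed to \<open>stationary_density\<close> as an unapplied
    predicate; unfolding both sides applies it to a function constant in time, where its definition
    can rewrite.\<close>
  have "stationary_density (deterministic_fp q0 D) h \<longleftrightarrow> h = g_inf q0 D" for h
    using stationary_density_fokker_planck_iff[OF q0 \<open>0 < D\<close>]
    by (simp add: stationary_density_def deterministic_fp_def)
  moreover have "stationary_density (stochastic_fp q0 lam D \<theta>) h \<longleftrightarrow> h = (\<lambda>v. f_inf q0 lam D v \<theta>)"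
    if "\<theta> \<in> {-1..1}" for \<theta> h
    using stationary_density_fokker_planck_iff[OF mixture_weight_pos[OF assms(2,3) that] \<open>0 < D\<close>, of h]
    by (simp add: stationary_density_def stochastic_fp_def f_inf_eq_g_inf)
  moreover have "f_bar q0 lam D v = (LINT \<omega>|M. f_inf q0 lam D v (\<Theta> \<omega>))" for v
    using f_bar_eq_expectation[OF _ assms(5)] \<open>0 < D\<close> by simp
  ultimately show ?thesis
    using energy_g_inf[OF q0 \<open>0 < D\<close>] energy_f_inf[OF assms(1-3)] f_bar_eq[OF assms(1-3)]
      energy_f_bar_eq_average[OF assms(1-3)] energy_f_bar[OF assms(1-3)] energy_ratio[OF assms(1-3)]
      energy_ratio_ge_1[OF assms(2,3)] tendsto_energy_ratio[OF \<open>0 < D\<close> q0]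
      filterlim_energy_f_bar[OF \<open>0 < D\<close> q0]
    by blast
qed

end
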